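(* Let $\mathcal{E}$ be the exponential distribution, with cdf $F_{\mathcal E}(x)=1-e^{-x}$ on $[0,\infty)$. For every integer $n\ge 2$, $$\mathrm{APX}(\mathcal{E},n)\ge \frac{1}{\max_{c\ge 0}g_n(c)},\qquad g_n(c)=c\left[1-\left(1-e^{-c(H_n-1)}\right)^n\right].$$ In particular, the upper bound $$\frac{1}{\max_{c\in[0,1]}g_n(c)}+\frac{(e-1)^{n-1}}{e^n-(e-1)^n}$$ on $\mathrm{APX}(F,n)$ for continuous MHR distributions $F$ is tight up to an exponentially vanishing additive term: as $n\to\infty$, $$\left(\frac{1}{\max_{c\in[0,1]}g_n(c)}+\frac{(e-1)^{n-1}}{e^n-(e-1)^n}\right)-\frac{1}{\max_{c\ge0}g_n(c)}=O\!\left(\left(\tfrac{e}{e-1}\right)^{-n}\right).$$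
   Context: For a continuous probability distribution with cdf $F$ and pdf $f$ on an interval $D_F\subseteq[0,\infty)$ and $n\ge2$ bidders with i.i.d. valuations from $F$, let $X_{n:n}$ be the maximum of $n$ i.i.d. draws from $F$ and $\phi(x)=x-\frac{1-F(x)}{f(x)}$ the virtual valuation. The optimal auction revenue (for MHR distributions, i.e. those with $f/(1-F)$ nondecreasing, such as the exponential) is $\mathrm{Myerson}(F,n)=\mathbb{E}[\max\{0,\phi(X_{n:n})\}]$, the optimal anonymous pricing revenue is $\mathrm{Price}(F,n)=\sup_{p\in D_F}p\,(1-F(p)^n)$, and $\mathrm{APX}(F,n)=\mathrm{Myerson}(F,n)/\mathrm{Price}(F,n)$. $H_n=\sum_{i=1}^n 1/i$ is the $n$-th harmonic number. *)

theory Defs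
  imports "HOL-Probability.Probability" "HOL-Library.Landau_Symbols"
begin

text \<open>
  A continuous distribution is represented by the interval \<open>D\<close> carrying it and its pdf
  \<open>f\<close>, extended by \<open>0\<close> outside \<open>D\<close>.  The exponential distribution is
  the pair \<open>{0..}\<close>, \<^term>\<open>exponential_density 1\<close>.
\<close>

definition valuation_measure :: "(real \<Rightarrow> real) \<Rightarrow> real measure" where
  "valuation_measure f = density lborel (\<lambda>x. ennreal (f x))"

definition valuation_cdf :: "(real \<Rightarrow> real) \<Rightarrow> real \<Rightarrow> real" where
  "valuation_cdf f = cdf (valuation_measure f)"

definition continuous_distribution :: "real set \<Rightarrow> (real \<Rightarrow> real) \<Rightarrow> bool" where
  "continuous_distribution D f \<longleftrightarrow>
     is_interval D \<and> D \<subseteq> {0..} \<and> f \<in> borel_measurable borel \<and>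
     (\<forall>x. 0 \<le> f x) \<and> (\<forall>x. x \<notin> D \<longrightarrow> f x = 0) \<and> prob_space (valuation_measure f)"

lemma valuation_cdf_exponential:
  assumes "0 \<le> x"
  shows "valuation_cdf (exponential_density 1) x = 1 - exp (- x)"
proof -
  have "emeasure (density lborel (exponential_density 1)) {..x} = ennreal (1 - exp (- x))"
    using emeasure_erlang_density[of 1 0 x] assms by (simp add: erlang_CDF_0)
  then show ?thesis
    using assms by (simp add: valuation_cdf_def valuation_measure_def cdf_def measure_def)
qed

text \<open>The hazard rate is only defined where \<open>F x < 1\<close>, which can fail at the right
  endpoint of \<open>D\<close>.\<close>

definition continuous_mhr :: "real set \<Rightarrow> (real \<Rightarrow> real) \<Rightarrow> bool" where
  "continuous_mhr D f \<longleftrightarrow> continuous_distribution D f \<and>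
     mono_on {x \<in> D. valuation_cdf f x < 1} (\<lambda>x. f x / (1 - valuation_cdf f x))"

definition virtual_valuation :: "(real \<Rightarrow> real) \<Rightarrow> real \<Rightarrow> real" where
  "virtual_valuation f x = x - (1 - valuation_cdf f x) / f x"

text \<open>The sample space is that of \<open>n\<close> independent draws; \<open>Max (v ` {..<n})\<close> is the
  maximum order statistic.\<close>

definition Myerson :: "(real \<Rightarrow> real) \<Rightarrow> nat \<Rightarrow> real" where
  "Myerson f n =
     (\<integral>v. max 0 (virtual_valuation f (Max (v ` {..<n}))) \<partial>(\<Pi>\<^sub>M i\<in>{..<n}. valuation_measure f))"

definition Price :: "real set \<Rightarrow> (real \<Rightarrow> real) \<Rightarrow> nat \<Rightarrow> real" where
  "Price D f n = (SUP p\<in>D. p * (1 - valuation_cdf f p ^ n))"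

definition APX :: "real set \<Rightarrow> (real \<Rightarrow> real) \<Rightarrow> nat \<Rightarrow> real" where
  "APX D f n = Myerson f n / Price D f n"

definition g :: "nat \<Rightarrow> real \<Rightarrow> real" where
  "g n c = c * (1 - (1 - exp (- c * (harm n - 1))) ^ n)"

text \<open>The maxima of \<open>g n\<close> below are written as suprema; the next two lemmas show that
  they are attained.\<close>

lemma g_attains_max_unit: "\<exists>c\<in>{0..1}. g n c = (SUP d\<in>{0..1}. g n d)"
proof -
  have "\<exists>c\<in>{0..1::real}. \<forall>d\<in>{0..1}. g n d \<le> g n c"
    by (rule continuous_attains_sup) (auto simp: g_def intro!: continuous_intros)
  then obtain c where c: "c \<in> {0..1}" "\<forall>d\<in>{0..1}. g n d \<le> g n c" by blast
  have "(SUP d\<in>{0..1}. g n d) = g n c"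
    by (rule cSup_eq_maximum) (use c in auto)
  with c show ?thesis by metis
qed

lemma g_attains_max:
  assumes "n \<ge> 2"
  shows "\<exists>c\<in>{0..}. g n c = (SUP d\<in>{0..}. g n d)"
proof -
  define a where "a = (harm n - 1 :: real)"
  have "harm 2 \<le> (harm n :: real)" using assms by (rule harm_mono)
  moreover have "harm 2 = (3/2 :: real)" by (simp add: harm_def numeral_2_eq_2)
  ultimately have a: "a > 0" by (simp add: a_def)
  have le: "g n c \<le> c * (real n * exp (- c * a))" if "c \<ge> 0" for c
  proof -
    have "exp (- c * a) \<le> 1" using that a by simp
    then have "1 + real n * (- exp (- c * a)) \<le> (1 + (- exp (- c * a))) ^ n"
      by (intro Bernoulli_inequality) simp
    then have "1 - (1 - exp (- c * a)) ^ n \<le> real n * exp (- c * a)" by simp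
    then show ?thesis unfolding g_def a_def[symmetric] using that by (rule mult_left_mono)
  qed
  have "((\<lambda>c. c * (real n * exp (- c * a))) \<longlongrightarrow> 0) at_top"
  proof -
    have "((\<lambda>y. y / exp y) \<longlongrightarrow> (0::real)) at_top"
      using tendsto_power_div_exp_0[of 1] by simp
    moreover have "filterlim (\<lambda>c. c * a) at_top at_top"
      by (rule filterlim_at_top_mult_tendsto_pos[OF tendsto_const a filterlim_ident])
    ultimately have "((\<lambda>c. (c * a) / exp (c * a)) \<longlongrightarrow> 0) at_top"
      by (rule filterlim_compose)
    then have "((\<lambda>c. (real n / a) * ((c * a) / exp (c * a))) \<longlongrightarrow> 0) at_top"
      by (rule tendsto_mult_right_zero)
    then show ?thesis using a by (simp add: exp_minus field_simps)
  qed
  moreover have pos: "g n 1 > 0"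
  proof -
    have "(1 - exp (- 1 * a)) ^ n < 1"
      using a assms by (intro power_less_one_iff[THEN iffD2]) auto
    then show ?thesis by (simp add: g_def a_def)
  qed
  ultimately have "\<forall>\<^sub>F c in at_top. c * (real n * exp (- c * a)) < g n 1"
    by (rule order_tendstoD(2))
  then obtain B where B: "\<And>c. c \<ge> B \<Longrightarrow> c * (real n * exp (- c * a)) < g n 1"
    by (auto simp: eventually_at_top_linorder)
  define B' where "B' = max B 1"
  have "\<exists>c\<in>{0..B'}. \<forall>d\<in>{0..B'}. g n d \<le> g n c"
    by (rule continuous_attains_sup) (auto simp: g_def B'_def intro!: continuous_intros)
  then obtain c where c: "c \<in> {0..B'}" "\<forall>d\<in>{0..B'}. g n d \<le> g n c" by blast
  have "g n d \<le> g n c" if "d \<ge> 0" for d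
  proof (cases "d \<le> B'")
    case False
    then have "B \<le> d" by (simp add: B'_def)
    then have "g n d \<le> g n 1" using le[OF that] B[of d] by linarith
    also have "\<dots> \<le> g n c" using c by (auto simp: B'_def)
    finally show ?thesis .
  qed (use c that in auto)
  then have "(SUP d\<in>{0..}. g n d) = g n c"
    by (intro cSup_eq_maximum) (use c in auto)
  with c show ?thesis by (metis atLeast_iff atLeastAtMost_iff)
qed

end

(* The virtual valuation of the exponential distribution is x - 1, and the maximum of n draws has
   expectation H_n, so the Myerson revenue is at least H_n - 1; substituting p = c (H_n - 1)
   identifies the best anonymous price revenue as (H_n - 1) max g_n. For the tightness claim, the
   two maxima of g_n agree for large n, because g_n is nonincreasing on [1, \<infinity>) as soon as
   (H_n - 1) (1 - exp (1 - H_n))^(n-1) is at least 1; what remains is the explicit error term. *)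

theory Submission
  imports Defs
begin

section \<open>Tail integrals and the expected maximum of independent draws\<close>

lemma nn_integral_layer_cake:
  fixes f :: "'a \<Rightarrow> real"
  assumes "sigma_finite_measure M" and f [measurable]: "f \<in> borel_measurable M"
  shows "(\<integral>\<^sup>+x. ennreal (f x) \<partial>M) =
    (\<integral>\<^sup>+t. emeasure M {x \<in> space M. t < f x} * indicator {0..} t \<partial>lborel)"
proof -
  interpret M: sigma_finite_measure M by fact
  interpret pair_sigma_finite M lborel ..
  \<comment> \<open>Each value is the length of [0, f x), which is empty for negative f x, in
    agreement with \<open>ennreal\<close> truncating at 0. Tonelli on the region under the graph
    then swaps the integrals.\<close>
  have "(\<integral>\<^sup>+x. ennreal (f x) \<partial>M) =
      (\<integral>\<^sup>+x. \<integral>\<^sup>+t. indicator {p \<in> space (M \<Otimes>\<^sub>M lborel). 0 \<le> snd p \<and> snd p < f (fst p)} (x, t) \<partial>lborel \<partial>M)"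
  proof (rule nn_integral_cong)
    fix x assume x: "x \<in> space M"
    have "ennreal (f x) = emeasure lborel {0..<f x}"
      by (cases "0 \<le> f x") (auto simp: ennreal_neg)
    also have "\<dots> = (\<integral>\<^sup>+t. indicator {0..<f x} t \<partial>lborel)" by simp
    also have "\<dots> = (\<integral>\<^sup>+t. indicator {p \<in> space (M \<Otimes>\<^sub>M lborel). 0 \<le> snd p \<and> snd p < f (fst p)} (x, t) \<partial>lborel)"
      using x by (intro nn_integral_cong) (auto simp: indicator_def space_pair_measure)
    finally show "ennreal (f x) = \<dots>" .
  qed
  also have "\<dots> = (\<integral>\<^sup>+t. \<integral>\<^sup>+x. indicator {p \<in> space (M \<Otimes>\<^sub>M lborel). 0 \<le> snd p \<and> snd p < f (fst p)} (x, t) \<partial>M \<partial>lborel)"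
    by (rule Fubini'[symmetric]) measurable
  also have "\<dots> = (\<integral>\<^sup>+t. emeasure M {x \<in> space M. t < f x} * indicator {0..} t \<partial>lborel)"
  proof (rule nn_integral_cong)
    fix t :: real
    have "(\<integral>\<^sup>+x. indicator {p \<in> space (M \<Otimes>\<^sub>M lborel). 0 \<le> snd p \<and> snd p < f (fst p)} (x, t) \<partial>M) =
        (\<integral>\<^sup>+x. indicator {0..} t * indicator {x \<in> space M. t < f x} x \<partial>M)"
      by (intro nn_integral_cong) (auto simp: indicator_def space_pair_measure)
    then show "(\<integral>\<^sup>+x. indicator {p \<in> space (M \<Otimes>\<^sub>M lborel). 0 \<le> snd p \<and> snd p < f (fst p)} (x, t) \<partial>M) =
        emeasure M {x \<in> space M. t < f x} * indicator {0..} t"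
      by (simp add: nn_integral_cmult mult.commute)
  qed
  finally show ?thesis .
qed

lemma space_valuation_measure [simp]: "space (valuation_measure f) = UNIV"
  by (simp add: valuation_measure_def)

lemma sets_valuation_measure [simp, measurable_cong]: "sets (valuation_measure f) = sets borel"
  by (simp add: valuation_measure_def)

lemma borel_measurable_Max_draws [measurable]:
  fixes n :: nat
  shows "(\<lambda>v. Max (v ` {..<n})) \<in> borel_measurable (\<Pi>\<^sub>M i\<in>{..<n}. valuation_measure f)"
proof (rule borel_measurable_Max)
  fix i assume "i \<in> {..<n}"
  then show "(\<lambda>v. v i) \<in> borel_measurable (\<Pi>\<^sub>M i\<in>{..<n}. valuation_measure f)"
    using measurable_component_singleton[of i "{..<n}" "\<lambda>_. valuation_measure f"] by simp
qed simp

lemma prob_space_draws: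
  assumes "prob_space (valuation_measure f)"
  shows "prob_space (\<Pi>\<^sub>M i\<in>I. valuation_measure f)"
  using assms by (intro prob_space_PiM)

lemma emeasure_Max_draws_greater:
  assumes N: "prob_space (valuation_measure f)" and n: "n > 0"
  shows "emeasure (\<Pi>\<^sub>M i\<in>{..<n}. valuation_measure f)
           {v \<in> space (\<Pi>\<^sub>M i\<in>{..<n}. valuation_measure f). t < Max (v ` {..<n})} =
         ennreal (1 - valuation_cdf f t ^ n)"
proof -
  let ?N = "valuation_measure f"
  let ?P = "\<Pi>\<^sub>M i\<in>{..<n}. ?N"
  interpret N: prob_space ?N by (rule N)
  interpret P: prob_space ?P by (rule prob_space_draws[OF N])
  interpret finite_product_prob_space "\<lambda>_. ?N" "{..<n}" by standard simp
  \<comment> \<open>The event is a box, so its probability is a product of n equal factors.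
    Positivity of n keeps \<open>Max\<close> away from the empty set.\<close>
  have "{v \<in> space ?P. Max (v ` {..<n}) \<le> t} = (\<Pi>\<^sub>E i\<in>{..<n}. {..t})"
    using n by (subst Max_le_iff) (auto simp: space_PiM PiE_def Pi_def)
  then have "P.prob {v \<in> space ?P. Max (v ` {..<n}) \<le> t} = (\<Prod>i<n. N.prob {..t})"
    using prob_times[of "\<lambda>_. {..t}"] by simp
  then have "P.prob {v \<in> space ?P. Max (v ` {..<n}) \<le> t} = valuation_cdf f t ^ n"
    by (simp add: valuation_cdf_def cdf_def)
  moreover have "P.prob {v \<in> space ?P. \<not> Max (v ` {..<n}) \<le> t} =
      1 - P.prob {v \<in> space ?P. Max (v ` {..<n}) \<le> t}"
    by (rule P.prob_neg) measurable
  ultimately show ?thesis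
    by (simp add: P.emeasure_eq_measure not_le)
qed

lemma prob_space_valuation_exponential: "prob_space (valuation_measure (exponential_density 1))"
  unfolding valuation_measure_def by (rule prob_space_exponential_density) simp

text \<open>By the geometric sum with ratio 1 - exp(-t), the integrand is the sum over k < n of
  exp(-t) (1 - exp(-t))^k, whose terms have the antiderivatives (1 - exp(-t))^(k+1) / (k+1). These
  vanish at 0 and tend to 1/(k+1) at infinity.\<close>

lemma nn_integral_exponential_max_tail:
  "(\<integral>\<^sup>+t. ennreal (1 - (1 - exp (- t)) ^ n) * indicator {0..} t \<partial>lborel) = ennreal (harm n)"
proof -
  define F :: "real \<Rightarrow> real" where "F t = (\<Sum>k<n. (1 - exp (- t)) ^ Suc k / real (Suc k))" for t
  have "DERIV F t :> 1 - (1 - exp (- t)) ^ n" for t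
  proof -
    have "((\<lambda>t. (1 - exp (- t)) ^ Suc k / real (Suc k)) has_real_derivative
        exp (- t) * (1 - exp (- t)) ^ k) (at t)" for k
      by (rule derivative_eq_intros refl | simp)+
    then have "DERIV F t :> (\<Sum>k<n. exp (- t) * (1 - exp (- t)) ^ k)"
      unfolding F_def by (intro DERIV_sum)
    also have "(\<Sum>k<n. exp (- t) * (1 - exp (- t)) ^ k) = 1 - (1 - exp (- t)) ^ n"
      using one_diff_power_eq[of "1 - exp (- t)" n] by (simp add: sum_distrib_left)
    finally show ?thesis .
  qed
  moreover have "(F \<longlongrightarrow> (\<Sum>k<n. (1 - 0) ^ Suc k / real (Suc k))) at_top"
    unfolding F_def by (intro tendsto_intros filterlim_compose[OF exp_at_bot filterlim_uminus_at_bot_at_top]) simp_all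
  moreover have "(\<Sum>k<n. (1 - 0) ^ Suc k / real (Suc k)) = harm n"
    by (simp add: harm_def sum.atLeast1_atMost_eq field_simps)
  moreover have "F 0 = 0" by (simp add: F_def)
  ultimately show ?thesis
    using nn_integral_FTC_atLeast[of "\<lambda>t. 1 - (1 - exp (- t)) ^ n" 0 F "harm n"]
    by (simp add: power_le_one)
qed

text \<open>For x >= 0 the hazard rate is 1. For x < 0 the density is 0, division by zero turns the
  virtual valuation into x, and the truncation makes both sides 0.\<close>

lemma max_0_virtual_valuation_exponential:
  "max 0 (virtual_valuation (exponential_density 1) x) = max 0 (x - 1)"
  by (cases "x < 0")
    (simp_all add: virtual_valuation_def exponential_density_def valuation_cdf_exponential)

lemma Myerson_exponential_ge:
  assumes "n > 0"
  shows "harm n - 1 \<le> Myerson (exponential_density 1) n"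
proof -
  let ?P = "\<Pi>\<^sub>M i\<in>{..<n}. valuation_measure (exponential_density 1)"
  let ?M = "\<lambda>v. Max (v ` {..<n}) :: real"
  interpret P: prob_space ?P by (rule prob_space_draws[OF prob_space_valuation_exponential])
  \<comment> \<open>The sample space contains negative draws. Truncating at 0 makes the integrand
    nonnegative everywhere and is invisible to \<open>ennreal\<close>.\<close>
  have "(\<integral>\<^sup>+v. ennreal (max 0 (?M v)) \<partial>?P) = (\<integral>\<^sup>+v. ennreal (?M v) \<partial>?P)"
    by simp
  also have "\<dots> = (\<integral>\<^sup>+t. emeasure ?P {v \<in> space ?P. t < ?M v} * indicator {0..} t \<partial>lborel)"
    by (rule nn_integral_layer_cake) (rule P.sigma_finite_measure_axioms, rule borel_measurable_Max_draws)
  also have "\<dots> = (\<integral>\<^sup>+t. ennreal (1 - (1 - exp (- t)) ^ n) * indicator {0..} t \<partial>lborel)"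
    using emeasure_Max_draws_greater[OF prob_space_valuation_exponential assms]
    by (intro nn_integral_cong) (simp add: valuation_cdf_exponential indicator_def)
  finally have nn: "(\<integral>\<^sup>+v. ennreal (max 0 (?M v)) \<partial>?P) = ennreal (harm n)"
    by (simp add: nn_integral_exponential_max_tail)
  have int: "integrable ?P (\<lambda>v. max 0 (?M v))"
    by (rule integrableI_nonneg) (use nn in auto)
  then have expectation: "(\<integral>v. max 0 (?M v) \<partial>?P) = harm n"
    using nn by (subst integral_eq_nn_integral) (auto simp: harm_nonneg)
  have int': "integrable ?P (\<lambda>v. max 0 (?M v - 1))"
    by (rule Bochner_Integration.integrable_bound[OF int]) auto
  \<comment> \<open>The pointwise inequality max 0 m - 1 \<le> max 0 (m - 1) suffices, because only
    a lower bound on the numerator of \<open>APX\<close> is wanted.\<close>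
  have "harm n - 1 = (\<integral>v. max 0 (?M v) - 1 \<partial>?P)"
    using expectation int by (simp add: P.prob_space)
  also have "\<dots> \<le> (\<integral>v. max 0 (?M v - 1) \<partial>?P)"
    by (rule integral_mono) (use int int' in auto)
  finally show ?thesis
    by (simp add: Myerson_def max_0_virtual_valuation_exponential)
qed

section \<open>Anonymous pricing and the lower bound on the ratio\<close>

lemma harm_gt_one:
  assumes "n \<ge> 2"
  shows "(harm n :: real) > 1"
proof -
  have "harm 2 \<le> (harm n :: real)" using assms by (rule harm_mono)
  then show ?thesis by (simp add: harm_def numeral_2_eq_2)
qed

text \<open>A crude bound whose purpose is to make the suprema of \<open>g n\<close> bounded above.
  It combines Bernoulli's inequality, 1 - (1 - u)^n \<le> n u, with y exp(-y) \<le> 1 at y = c (H_n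
  - 1).\<close>

lemma g_le:
  assumes "n \<ge> 2" "c \<ge> 0"
  shows "g n c \<le> real n / (harm n - 1)"
proof -
  define a where "a = (harm n - 1 :: real)"
  have a: "a > 0" using harm_gt_one[OF assms(1)] by (simp add: a_def)
  have "1 + real n * (- exp (- c * a)) \<le> (1 + (- exp (- c * a))) ^ n"
    using a assms by (intro Bernoulli_inequality) simp
  then have "g n c \<le> c * (real n * exp (- c * a))"
    unfolding g_def a_def[symmetric] using assms by (intro mult_left_mono) auto
  also have "\<dots> = real n / a * (c * a * exp (- (c * a)))"
    using a by simp
  also have "\<dots> \<le> real n / a * 1"
  proof (rule mult_left_mono)
    show "c * a * exp (- (c * a)) \<le> 1"
      using exp_ge_add_one_self[of "c * a"] by (simp add: exp_minus divide_simps del: exp_ge_add_one_self)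
  qed (use a in simp)
  finally show ?thesis by (simp add: a_def)
qed

lemma g_le_SUP:
  assumes "n \<ge> 2" "c \<ge> 0"
  shows "g n c \<le> (SUP d\<in>{0..}. g n d)"
  using assms by (intro cSUP_upper bdd_aboveI2[of _ _ "real n / (harm n - 1)"] g_le) auto

lemma SUP_g_pos:
  assumes "n \<ge> 2"
  shows "(SUP d\<in>{0..}. g n d) > 0"
proof -
  have "(1 - exp (- 1 * (harm n - 1))) ^ n < (1::real)"
    using harm_gt_one[OF assms] assms by (intro power_less_one_iff[THEN iffD2]) auto
  then have "g n 1 > 0" by (simp add: g_def)
  then show ?thesis using g_le_SUP[OF assms, of 1] by simp
qed

text \<open>Since H_n > 1, the substitution p = c (H_n - 1) maps [0, \<infinity>) onto itself, and
  it scales the objective by H_n - 1. A maximizer of \<open>g n\<close> thus yields an optimal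
  price.\<close>

lemma Price_exponential:
  assumes "n \<ge> 2"
  shows "Price {0..} (exponential_density 1) n = (harm n - 1) * (SUP c\<in>{0..}. g n c)"
proof -
  define a where "a = (harm n - 1 :: real)"
  have a: "a > 0" using harm_gt_one[OF assms] by (simp add: a_def)
  have price: "p * (1 - valuation_cdf (exponential_density 1) p ^ n) = a * g n (p / a)"
    if "p \<ge> 0" for p
    using that a by (simp add: g_def valuation_cdf_exponential flip: a_def)
  obtain c where c: "c \<ge> 0" "g n c = (SUP d\<in>{0..}. g n d)"
    using g_attains_max[OF assms] by auto
  have "Price {0..} (exponential_density 1) n = a * g n c"
    unfolding Price_def
  proof (rule cSup_eq_maximum)
    show "a * g n c \<in> (\<lambda>p. p * (1 - valuation_cdf (exponential_density 1) p ^ n)) ` {0..}"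
      using price[of "a * c"] a c by (intro image_eqI[of _ _ "a * c"]) auto
  next
    fix y assume "y \<in> (\<lambda>p. p * (1 - valuation_cdf (exponential_density 1) p ^ n)) ` {0..}"
    then obtain p where "p \<ge> 0" "y = a * g n (p / a)" using price by auto
    then show "y \<le> a * g n c"
      using a c g_le_SUP[OF assms, of "p / a"] by simp
  qed
  then show ?thesis using c by (simp add: a_def)
qed

lemma APX_exponential_ge:
  assumes "n \<ge> 2"
  shows "APX {0..} (exponential_density 1) n \<ge> 1 / (SUP c\<in>{0..}. g n c)"
proof -
  define a S where "a = (harm n - 1 :: real)" and "S = (SUP c\<in>{0..}. g n c)"
  have "a > 0" "S > 0"
    using harm_gt_one[OF assms] SUP_g_pos[OF assms] by (simp_all add: a_def S_def)
  then have "1 / S = a / (a * S)" by simp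
  also have "\<dots> \<le> Myerson (exponential_density 1) n / (a * S)"
    using \<open>a > 0\<close> \<open>S > 0\<close> Myerson_exponential_ge[of n] assms
    by (intro divide_right_mono) (auto simp: a_def)
  finally show ?thesis
    by (simp add: APX_def Price_exponential[OF assms] a_def S_def)
qed

text \<open>The hazard rate is constantly 1 on [0, \<infinity>). This places the exponential
  distribution in the class to which the upper bound refers, as the tightness claim
  requires.\<close>

lemma continuous_mhr_exponential: "continuous_mhr {0..} (exponential_density 1)"
  unfolding continuous_mhr_def continuous_distribution_def
  using prob_space_valuation_exponential
  by (auto simp: is_interval_ci exponential_density_def valuation_cdf_exponential
      intro!: mono_onI)

section \<open>Agreement of the two maxima for large n\<close>

lemma g_le_g_1:
  assumes n: "n \<ge> 2" and c: "c \<ge> 1"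
    and large: "1 \<le> (harm n - 1 :: real) * (1 - exp (- (harm n - 1))) ^ (n - 1)"
  shows "g n c \<le> g n 1"
proof (rule DERIV_nonpos_imp_nonincreasing[OF c])
  fix x :: real assume x: "1 \<le> x"
  define a where "a = (harm n - 1 :: real)"
  define u where "u = exp (- x * a)"
  have a: "a > 0" using harm_gt_one[OF n] by (simp add: a_def)
  have u: "0 < u" "u \<le> exp (- a)" using a x by (auto simp: u_def)
  moreover have "exp (- a) \<le> 1" using a by simp
  ultimately have "u \<le> 1" by linarith
  have "(g n has_real_derivative
      (1 - (1 - u) ^ n) - x * (real n * (1 - u) ^ (n - 1) * (a * u))) (at x)"
    unfolding g_def a_def[symmetric] u_def
    by (rule derivative_eq_intros refl | simp add: algebra_simps)+
  \<comment> \<open>Bernoulli's inequality bounds the derivative by n u (1 - x a (1 - u)^(n-1)). As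
    x \<ge> 1 and u \<le> exp(-a), the hypothesis \<open>large\<close> makes the bracket
    nonpositive.\<close>
  moreover have "(1 - (1 - u) ^ n) - x * (real n * (1 - u) ^ (n - 1) * (a * u)) \<le> 0"
  proof -
    have "1 + real n * (- u) \<le> (1 + (- u)) ^ n"
      using \<open>u \<le> 1\<close> by (intro Bernoulli_inequality) simp
    then have "1 - (1 - u) ^ n \<le> real n * u * 1" by simp
    also have "\<dots> \<le> real n * u * (x * (a * (1 - u) ^ (n - 1)))"
    proof (rule mult_left_mono)
      have "1 \<le> a * (1 - exp (- a)) ^ (n - 1)" using large by (simp add: a_def)
      also have "\<dots> \<le> a * (1 - u) ^ (n - 1)"
        using a u \<open>exp (- a) \<le> 1\<close> by (intro mult_left_mono power_mono) auto
      finally have "1 \<le> a * (1 - u) ^ (n - 1)" .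
      with x show "1 \<le> x * (a * (1 - u) ^ (n - 1))"
        using mult_mono[of 1 x 1 "a * (1 - u) ^ (n - 1)"] by simp
    qed (use u in simp)
    finally show ?thesis by (simp add: mult_ac)
  qed
  ultimately show "\<exists>y. (g n has_real_derivative y) (at x) \<and> y \<le> 0" by blast
qed

text \<open>From H_n \<ge> ln (n + 1) follows exp(1 - H_n) \<le> e/n, so the power is at least (1 -
  e/n)^n, which tends to exp(-e) > 0, while H_n - 1 diverges.\<close>

lemma eventually_g_decreasing_condition:
  "\<forall>\<^sub>F n in sequentially. 1 \<le> (harm n - 1 :: real) * (1 - exp (- (harm n - 1))) ^ (n - 1) \<and> n \<ge> 2"
proof -
  have "filterlim (\<lambda>n. (harm n - 1) * (1 + (- exp 1) / real n) ^ n) at_top sequentially"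
  proof (rule filterlim_at_top_mult_tendsto_pos)
    show "filterlim (\<lambda>n. harm n - 1 :: real) at_top sequentially"
      using filterlim_tendsto_add_at_top[OF tendsto_const[of "-1"] harm_at_top] by simp
  qed (rule tendsto_exp_limit_sequentially, simp)
  then have "\<forall>\<^sub>F n in sequentially. 1 \<le> (harm n - 1) * (1 + (- exp 1) / real n) ^ n"
    by (simp add: filterlim_at_top)
  \<comment> \<open>For n \<ge> 3 > e the base 1 - e/n is nonnegative, so that powers are monotone
    in it and decrease with the exponent.\<close>
  with eventually_ge_at_top[of 3] show ?thesis
  proof eventually_elim
    case (elim n)
    define a where "a = (harm n - 1 :: real)"
    have a: "a > 0" using harm_gt_one[of n] elim by (simp add: a_def)
    have "ln (real n) \<le> ln (real n + 1)" using elim by simp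
    then have "exp (- a) \<le> exp (1 - ln (real n))"
      using ln_le_harm[of n] by (simp add: a_def)
    also have "\<dots> = exp 1 / real n" using elim by (simp add: exp_diff)
    finally have u: "exp (- a) \<le> exp 1 / real n" .
    have "exp 1 / real n \<le> 1" using elim exp_le by simp
    then have "(1 + (- exp 1) / real n) ^ n \<le> (1 + (- exp 1) / real n) ^ (n - 1)"
      by (intro power_decreasing) auto
    also have "\<dots> \<le> (1 - exp (- a)) ^ (n - 1)"
      using u \<open>exp 1 / real n \<le> 1\<close> by (intro power_mono) auto
    finally have "a * (1 + (- exp 1) / real n) ^ n \<le> a * (1 - exp (- a)) ^ (n - 1)"
      using a by simp
    then show ?case using elim by (simp add: a_def)
  qed
qed

lemma eventually_SUP_g_eq:
  "\<forall>\<^sub>F n in sequentially. (SUP c\<in>{0..}. g n c) = (SUP c\<in>{0..1}. g n c)"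
  using eventually_g_decreasing_condition
proof eventually_elim
  case (elim n)
  obtain c where c: "c \<in> {0..1}" "g n c = (SUP d\<in>{0..1}. g n d)"
    using g_attains_max_unit by blast
  have "bdd_above (g n ` {0..1})"
    using elim by (intro bdd_aboveI2[of _ _ "real n / (harm n - 1)"] g_le) auto
  then have le: "g n d \<le> g n c" if "d \<in> {0..1}" for d
    using c(2) that by (simp add: cSUP_upper)
  have "(SUP d\<in>{0..}. g n d) = g n c"
  proof (rule cSup_eq_maximum)
    fix y assume "y \<in> g n ` {0..}"
    then obtain d where d: "d \<ge> 0" "y = g n d" by auto
    show "y \<le> g n c"
    proof (cases "d \<le> 1")
      case False
      then show ?thesis using d g_le_g_1[of n d] le[of 1] elim by auto
    qed (use d le in auto)
  qed (use c(1) in auto)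
  then show ?case using c by simp
qed

section \<open>The exponentially small error term\<close>

lemma error_term_bound:
  fixes e :: real
  assumes e: "e > 1" and n: "n \<ge> 1"
  shows "(e - 1) ^ (n - 1) / (e ^ n - (e - 1) ^ n) \<le> e / (e - 1) * (e / (e - 1)) powr (- real n)"
proof -
  have "(e - 1) ^ n = (e - 1) * (e - 1) ^ (n - 1)" "e ^ n = e * e ^ (n - 1)"
    using n by (simp_all flip: power_Suc)
  \<comment> \<open>Subtracting this from e^n = e * e^(n-1) leaves at least e^(n-1) in the
    denominator. The quotient is then at most ((e-1)/e)^(n-1), and the shift of the exponent to n
    costs the constant e/(e-1).\<close>
  moreover have "(e - 1) * (e - 1) ^ (n - 1) \<le> (e - 1) * e ^ (n - 1)"
    using e by (intro mult_left_mono power_mono) auto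
  ultimately have "e ^ (n - 1) \<le> e ^ n - (e - 1) ^ n"
    by (simp add: algebra_simps)
  moreover have "0 < e ^ (n - 1)" using e by simp
  ultimately have "(e - 1) ^ (n - 1) / (e ^ n - (e - 1) ^ n) \<le> (e - 1) ^ (n - 1) / e ^ (n - 1)"
    using e by (intro divide_left_mono mult_pos_pos) (linarith | simp)+
  also have "\<dots> = e / (e - 1) * (e / (e - 1)) powr (- real n)"
  proof -
    have "(e / (e - 1)) powr (- real n) = ((e - 1) / e) ^ n"
      using e by (simp add: powr_minus powr_realpow power_divide)
    then show ?thesis using e n by (cases n) (simp_all add: power_divide)
  qed
  finally show ?thesis .
qed

lemma error_term_bigo:
  fixes e :: real
  assumes e: "e > 1"
  shows "(\<lambda>n. (e - 1) ^ (n - 1) / (e ^ n - (e - 1) ^ n)) \<in> O(\<lambda>n. (e / (e - 1)) powr (- real n))"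
proof (rule bigoI[of _ "e / (e - 1)"])
  show "\<forall>\<^sub>F n in sequentially. norm ((e - 1) ^ (n - 1) / (e ^ n - (e - 1) ^ n))
      \<le> e / (e - 1) * norm ((e / (e - 1)) powr (- real n))"
    using eventually_ge_at_top[of 1]
  proof eventually_elim
    case (elim n)
    have "(e - 1) ^ n \<le> e ^ n" using e by (intro power_mono) auto
    then show ?case using error_term_bound[OF e elim] e by simp
  qed
qed

theorem theorem4p4:
  shows "(\<forall>n\<ge>2. APX {0..} (exponential_density 1) n \<ge> 1 / (SUP c\<in>{0..}. g n c))
    \<and> continuous_mhr {0..} (exponential_density 1)
    \<and> (\<lambda>n. (1 / (SUP c\<in>{0..1}. g n c) + (exp 1 - 1) ^ (n - 1) / (exp 1 ^ n - (exp 1 - 1) ^ n))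
            - 1 / (SUP c\<in>{0..}. g n c))
        \<in> O(\<lambda>n. (exp 1 / (exp 1 - 1)) powr (- real n))"
proof (intro conjI allI impI)
  \<comment> \<open>Once the suprema coincide, their reciprocals cancel. The O-class ignores the
    finitely many n where this is not established.\<close>
  have "\<forall>\<^sub>F n in sequentially.
      (1 / (SUP c\<in>{0..1}. g n c) + (exp 1 - 1) ^ (n - 1) / (exp 1 ^ n - (exp 1 - 1) ^ n))
        - 1 / (SUP c\<in>{0..}. g n c) = (exp 1 - 1) ^ (n - 1) / (exp 1 ^ n - (exp 1 - 1) ^ n)"
    using eventually_SUP_g_eq by eventually_elim simp
  then show "(\<lambda>n. (1 / (SUP c\<in>{0..1}. g n c) + (exp 1 - 1) ^ (n - 1) / (exp 1 ^ n - (exp 1 - 1) ^ n))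
      - 1 / (SUP c\<in>{0..}. g n c)) \<in> O(\<lambda>n. (exp 1 / (exp 1 - 1)) powr (- real n))"
    by (rule iffD2[OF landau_o.big.in_cong]) (rule error_term_bigo, simp)
qed (rule APX_exponential_ge continuous_mhr_exponential; assumption)+

end
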